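(* Let $A\in\mathbb{R}^{m\times n}$ with $\operatorname{rank}(A)\ge 2$, let $b\in\mathbb{R}^m$, and suppose that the linear system $Ax=b$ is consistent. Let $r$ be a positive integer, let $x^1=x^0\in\mathbb{R}^n$ be arbitrary initial vectors, and let $x_0^*=A^{\dagger}b+(I-A^\dagger A)x^0$. Let $\{x^k\}_{k=0}^{\infty}$ be the iteration sequence generated by the randomized $r$-sets-Douglas-Rachford method with momentum (mRrDR). Assume that the relaxation parameter satisfies $$0<\alpha<\min\left\{1,\ \frac{1}{1-\left(1-2\sigma_{\max}^2(A)/\|A\|^2_F\right)^{r}}\right\}$$ and the momentum parameter satisfies $$\left(1-\sqrt{\alpha\left(1-\left(1-2\frac{\sigma_{\min}^2(A)}{\|A\|^2_F}\right)^r\right)}\right)^2<\beta<1.$$ Then there exists a constant $c>0$ (independent of $k$) such that, for all $k\ge0$, $$\left\|\mathbb{E}\left[x^k-x_0^*\right]\right\|_2^2\leq \beta^k c.$$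
   Context: Notation: $a_1^\top,\dots,a_m^\top$ are the rows of $A$, $b=(b_1,\dots,b_m)^\top$, $A^\dagger$ is the Moore-Penrose pseudoinverse, $\|A\|_F$ the Frobenius norm, $\sigma_{\max}(A)$ the largest singular value and $\sigma_{\min}(A)$ the smallest nonzero singular value of $A$. mRrDR method: given (deterministic) initial vectors $x^0,x^1\in\mathbb{R}^n$, a positive integer $r$, a relaxation parameter $\alpha$ and a momentum parameter $\beta$, for each $k=1,2,\dots$ set $z_0^k:=x^k$; for $\ell=1,\dots,r$ select a random index $j_{k_\ell}\in\{1,\dots,m\}$, independently of all other selections, with $\Pr(j_{k_\ell}=i)=\|a_i\|_2^2/\|A\|_F^2$ (so zero rows are never selected), and set $$z_\ell^k:=z_{\ell-1}^k-2\frac{\langle a_{j_{k_\ell}},z_{\ell-1}^k\rangle-b_{j_{k_\ell}}}{\|a_{j_{k_\ell}}\|_2^2}\,a_{j_{k_\ell}};$$ then set $x^{k+1}:=(1-\alpha)x^k+\alpha z_r^k+\beta(x^k-x^{k-1})$. The expectation is over all random row selections. *)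

theory Defs
  imports "HOL-Analysis.Analysis" "HOL-Probability.Probability"
begin

definition is_moore_penrose_inverse :: "real^'n^'m \<Rightarrow> real^'m^'n \<Rightarrow> bool" where
  "is_moore_penrose_inverse A X \<longleftrightarrow>
     A ** X ** A = A \<and> X ** A ** X = X \<and>
     transpose (A ** X) = A ** X \<and> transpose (X ** A) = X ** A"

definition pinv :: "real^'n^'m \<Rightarrow> real^'m^'n" where
  "pinv A = (THE X. is_moore_penrose_inverse A X)"

definition frobenius_norm :: "real^'n^'m \<Rightarrow> real" where
  "frobenius_norm A = sqrt (\<Sum>i\<in>UNIV. \<Sum>j\<in>UNIV. (A $ i $ j)\<^sup>2)"

lemma frobenius_norm_eq_norm: "frobenius_norm A = norm A"
  by (simp add: frobenius_norm_def norm_vec_def L2_set_def sum_nonneg)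

text \<open>
  Singular values are the nonnegative square roots of the eigenvalues of the
  \<open>n \<times> n\<close> matrix \<open>A\<^sup>T A\<close>. If \<open>n > m\<close> this set contains 0 even when \<open>A A\<^sup>T\<close> is regular;
  that affects neither the largest singular value nor the smallest nonzero one.
\<close>

definition singular_values :: "real^'n^'m \<Rightarrow> real set" where
  "singular_values A =
     {s. 0 \<le> s \<and> (\<exists>v. v \<noteq> 0 \<and> (transpose A ** A) *v v = s\<^sup>2 *\<^sub>R v)}"

definition sigma_max :: "real^'n^'m \<Rightarrow> real" where
  "sigma_max A = Max (singular_values A)"

text \<open>Smallest \<^emph>\<open>nonzero\<close> singular value; only meaningful for \<open>A \<noteq> 0\<close>.\<close>

definition sigma_min :: "real^'n^'m \<Rightarrow> real" where
  "sigma_min A = Min (singular_values A - {0})"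

text \<open>
  Reflection of \<open>z\<close> in the hyperplane of the \<open>i\<close>-th equation. For a zero row this is the
  identity (division by zero is zero); such rows are selected with probability 0.
\<close>

definition row_reflection :: "real^'n^'m \<Rightarrow> real^'m \<Rightarrow> 'm \<Rightarrow> real^'n \<Rightarrow> real^'n" where
  "row_reflection A b i z =
     z - (2 * ((row i A \<bullet> z - b $ i) / (norm (row i A))\<^sup>2)) *\<^sub>R row i A"

text \<open>
  \<open>reflections A b js x l\<close> is \<open>z\<^sub>l\<close>, where \<open>z\<^sub>0 = x\<close> and the \<open>l\<close>-th reflection
  (\<open>l \<ge> 1\<close>) uses row \<open>js l\<close>; \<open>js 0\<close> is never used.
\<close>

primrec reflections ::
    "real^'n^'m \<Rightarrow> real^'m \<Rightarrow> (nat \<Rightarrow> 'm) \<Rightarrow> real^'n \<Rightarrow> nat \<Rightarrow> real^'n" where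
  "reflections A b js x 0 = x"
| "reflections A b js x (Suc l) = row_reflection A b (js (Suc l)) (reflections A b js x l)"

text \<open>
  The mRrDR iterates for one realisation \<open>j\<close> of the row selections: \<open>j k l\<close> is the row used
  in the \<open>l\<close>-th reflection (\<open>1 \<le> l \<le> r\<close>) of the step from iterate \<open>k \<ge> 1\<close> to iterate \<open>k + 1\<close>.
\<close>

fun mRrDR ::
    "real^'n^'m \<Rightarrow> real^'m \<Rightarrow> nat \<Rightarrow> real \<Rightarrow> real \<Rightarrow> real^'n \<Rightarrow> real^'n
     \<Rightarrow> (nat \<Rightarrow> nat \<Rightarrow> 'm) \<Rightarrow> nat \<Rightarrow> real^'n" where
  "mRrDR A b r \<alpha> \<beta> x0 x1 j 0 = x0"
| "mRrDR A b r \<alpha> \<beta> x0 x1 j (Suc 0) = x1"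
| "mRrDR A b r \<alpha> \<beta> x0 x1 j (Suc (Suc k)) =
     (1 - \<alpha>) *\<^sub>R mRrDR A b r \<alpha> \<beta> x0 x1 j (Suc k)
     + \<alpha> *\<^sub>R reflections A b (j (Suc k)) (mRrDR A b r \<alpha> \<beta> x0 x1 j (Suc k)) r
     + \<beta> *\<^sub>R (mRrDR A b r \<alpha> \<beta> x0 x1 j (Suc k) - mRrDR A b r \<alpha> \<beta> x0 x1 j k)"

text \<open>
  Admissible random row selections on a probability space: the whole family of
  selections is independent, and each selects row \<open>i\<close> with probability
  proportional to its squared norm.
\<close>

definition random_row_selections ::
    "'w measure \<Rightarrow> real^'n^'m \<Rightarrow> nat \<Rightarrow> (nat \<Rightarrow> nat \<Rightarrow> 'w \<Rightarrow> 'm) \<Rightarrow> bool" where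
  "random_row_selections M A r J \<longleftrightarrow>
     prob_space M \<and>
     prob_space.indep_vars M (\<lambda>_. count_space UNIV) (\<lambda>(k, l). J k l) ({1..} \<times> {1..r}) \<and>
     (\<forall>k\<ge>1. \<forall>l\<in>{1..r}. \<forall>i.
        measure M {\<omega> \<in> space M. J k l \<omega> = i} = (norm (row i A))\<^sup>2 / (frobenius_norm A)\<^sup>2)"

end

theory Submission
  imports Defs
begin

text \<open>
  Let \<open>e k\<close> be the expectation of \<open>X k - xstar\<close>. Since \<open>xstar\<close> solves the system, each row reflection
  acts on the error \<open>z - xstar\<close> as a linear map. A fresh selection is independent of the current
  point, so one reflection acts on the mean error as \<open>T = I - 2 S\<close>, where \<open>S\<close> is the Gram
  matrix of \<open>A\<close> divided by the squared Frobenius norm (\<open>expected_reflections\<close>). Hence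
  \<open>e (k + 2) = Q (e (k + 1)) - \<beta> e k\<close> with \<open>Q = (1 - \<alpha> + \<beta>) I + \<alpha> T ^ r\<close>
  (\<open>expected_error_recurrence\<close>). Because \<open>x0 - xstar\<close> lies in the row space of \<open>A\<close>, which \<open>T\<close> preserves,
  all mean errors lie there (\<open>pinv_affine_solution\<close>).

  Let \<open>s\<close> be the smallest eigenvalue of \<open>S\<close> on the row space. As the rank is at least two, a unit
  vector of the row space has an orthogonal companion there, and by Bessel's inequality the two
  values of the form of \<open>S\<close> add up to at most one. So all values lie between \<open>s\<close> and \<open>1 - s\<close>, which
  says that \<open>T\<close> has norm at most \<open>t = 1 - 2 s\<close> on the row space (\<open>mean_reflection_contraction\<close>).
  Consequently \<open>Q\<close> has norm at most \<open>c = 1 - p + \<beta>\<close> there, with \<open>p = \<alpha> (1 - t ^ r)\<close>.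

  The lower bound on \<open>\<beta>\<close> says exactly that \<open>sqrt \<beta> > 1 - sqrt p\<close>, and this makes \<open>c\<close> smaller than
  \<open>2 sqrt \<beta>\<close> (\<open>negative_discriminant\<close>). In every eigendirection the recurrence then has complex
  characteristic roots of modulus \<open>sqrt \<beta>\<close>, which is the asserted rate. The proof replaces the
  diagonalisation by a quadratic form in two consecutive errors that is multiplied by \<open>\<beta>\<close> in
  every step and dominates the squared norm (\<open>momentum_recurrence_decay\<close>).
\<close>

section \<open>The row space and the Moore-Penrose inverse\<close>

definition row_space :: "real^'n^'m \<Rightarrow> (real^'n) set" where
  "row_space A = range (\<lambda>y. y v* A)"

lemma vector_matrix_mem_row_space [simp, intro]: "y v* A \<in> row_space A"
  by (simp add: row_space_def)

lemma linear_vector_matrix_mult: "linear (\<lambda>y. y v* (A :: real^'n^'m))"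
  using matrix_vector_mul_linear[of "transpose A"] by simp

lemma subspace_row_space: "subspace (row_space A)"
  unfolding row_space_def by (intro linear_subspace_image linear_vector_matrix_mult subspace_UNIV)

lemma dim_row_space: "dim (row_space A) = rank A"
proof -
  have "row_space A = range (\<lambda>y. transpose A *v y)"
    by (simp add: row_space_def)
  then show ?thesis
    by (metis rank_dim_range rank_transpose)
qed

lemma row_space_nontrivial:
  assumes "rank A > 0"
  shows "\<exists>v\<in>row_space A. v \<noteq> 0"
proof -
  have "\<not> row_space A \<subseteq> {0}"
    using assms dim_row_space[of A] by (metis dim_eq_0 less_irrefl)
  then show ?thesis by blast
qed

lemma gram_eq_0_iff: "(A *v v) v* A = 0 \<longleftrightarrow> A *v v = (0 :: real^'m)" for A :: "real^'n^'m"
  by (metis dot_lmul_matrix inner_eq_zero_iff inner_zero_left vector_matrix_mult_0)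

lemma row_space_kernel_trivial:
  assumes "v \<in> row_space A" "A *v v = 0"
  shows "v = 0"
proof -
  obtain y where "v = y v* A"
    using assms(1) by (auto simp: row_space_def)
  then have "v \<bullet> v = y \<bullet> (A *v v)"
    by (simp add: dot_lmul_matrix)
  then show ?thesis
    by (simp add: assms(2))
qed

lemma gram_inj_on_row_space:
  fixes A :: "real^'n^'m"
  assumes "v \<in> row_space A" "w \<in> row_space A" "(A *v v) v* A = (A *v w) v* A"
  shows "v = w"
proof -
  have "(A *v (v - w)) v* A = 0"
    using assms(3) linear_diff[OF linear_vector_matrix_mult, of "A *v v" "A *v w" A]
    by (simp add: matrix_vector_mult_diff_distrib)
  then have "v - w = 0"
    using assms(1,2) row_space_kernel_trivial[of "v - w" A] subspace_diff[OF subspace_row_space]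
    by (auto simp: gram_eq_0_iff)
  then show ?thesis by simp
qed

text \<open>The least-squares problem is solvable because the component of \<open>y\<close> orthogonal to the
  range of \<open>A\<close> is annihilated by the transpose of \<open>A\<close>; discarding the kernel component of a
  solution then leaves one in the row space.\<close>

lemma normal_equation_solvable:
  fixes A :: "real^'n^'m"
  shows "\<exists>w\<in>row_space A. (A *v w) v* A = y v* A"
proof -
  obtain p q where p: "p \<in> span (range ((*v) A))"
    and q: "\<And>w. w \<in> span (range ((*v) A)) \<Longrightarrow> orthogonal q w" and y: "y = p + q"
    using orthogonal_subspace_decomp_exists[of "range ((*v) A)" y] by metis
  have "span (range ((*v) A)) = range ((*v) A)"
    by (intro span_eq_iff[THEN iffD2] linear_subspace_image matrix_vector_mul_linear) auto
  with p obtain z where z: "p = A *v z" by auto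
  have "q v* A = 0"
  proof (rule vector_eq_rdot[THEN iffD1], intro allI)
    fix u
    show "(q v* A) \<bullet> u = 0 \<bullet> u"
      using q[OF span_base, of "A *v u"] by (simp add: dot_lmul_matrix orthogonal_def)
  qed
  then have yA: "y v* A = p v* A"
    by (simp add: y linear_add[OF linear_vector_matrix_mult])
  obtain w n where w: "w \<in> span (row_space A)"
    and n: "\<And>u. u \<in> span (row_space A) \<Longrightarrow> orthogonal n u" and zw: "z = w + n"
    using orthogonal_subspace_decomp_exists[of "row_space A" z] by metis
  have "((A *v n) v* A) \<bullet> n = 0"
    using n[OF span_base, of "(A *v n) v* A"] by (simp add: orthogonal_def inner_commute)
  then have "A *v n = 0"
    by (simp add: dot_lmul_matrix)
  then have "A *v z = A *v w"
    by (simp add: zw matrix_vector_right_distrib)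
  moreover have "w \<in> row_space A"
    using w span_eq_iff[THEN iffD2, OF subspace_row_space, of A] by simp
  ultimately show ?thesis
    using yA z by auto
qed

text \<open>The Gram operator is injective on the row space, so the solution \<open>f y\<close> of the normal equations
  that lies there is unique, and hence linear in \<open>y\<close>. Its matrix is the pseudoinverse:
  \<open>A f\<close> and \<open>f A\<close> act as the orthogonal projections onto the range and the row space, and a map
  \<open>P\<close> with \<open>P x \<bullet> u = P x \<bullet> P u\<close> is symmetric.\<close>

lemma moore_penrose_inverse_exists:
  fixes A :: "real^'n^'m"
  shows "\<exists>X. is_moore_penrose_inverse A X"
proof -
  obtain f where fW: "\<And>y. f y \<in> row_space A" and f: "\<And>y. (A *v f y) v* A = y v* A"
    using normal_equation_solvable[of A] by metis
  have f_unique: "w = f y" if "w \<in> row_space A" "(A *v w) v* A = y v* A" for w y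
    using gram_inj_on_row_space[OF that(1) fW] that(2) f by metis
  have "linear f"
  proof (rule linearI)
    fix y z
    show "f (y + z) = f y + f z"
      by (rule f_unique[symmetric])
        (simp_all add: subspace_add subspace_row_space fW matrix_vector_right_distrib
          linear_add[OF linear_vector_matrix_mult] f)
  next
    fix c y
    show "f (c *\<^sub>R y) = c *\<^sub>R f y"
      by (rule f_unique[symmetric])
        (simp_all add: subspace_scale subspace_row_space fW matrix_vector_mult_scaleR
          linear_scale[OF linear_vector_matrix_mult] f)
  qed
  then have X: "matrix f *v y = f y" for y
    by simp
  have AfA: "A *v f (A *v x) = A *v x" for x
  proof -
    have "(A *v (f (A *v x) - x)) v* A = 0"
      using f[of "A *v x"]
      by (simp add: matrix_vector_mult_diff_distrib linear_diff[OF linear_vector_matrix_mult])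
    then have "A *v (f (A *v x) - x) = 0"
      by (simp only: gram_eq_0_iff)
    then show ?thesis
      by (simp add: matrix_vector_mult_diff_distrib)
  qed
  have symmetricI: "transpose B = B" if "\<And>x y. (B *v x) \<bullet> y = x \<bullet> (B *v y)" for B :: "real^'k^'k"
  proof (rule matrix_eq[THEN iffD2], intro allI, rule vector_eq_rdot[THEN iffD1], intro allI)
    fix x u
    show "(transpose B *v x) \<bullet> u = (B *v x) \<bullet> u"
      by (simp add: dot_lmul_matrix that)
  qed
  have fA: "f (A *v x) \<bullet> u = f (A *v x) \<bullet> f (A *v u)" for x u
  proof -
    obtain y where "f (A *v x) = y v* A"
      using fW[of "A *v x"] by (auto simp: row_space_def)
    then show ?thesis
      by (simp add: dot_lmul_matrix AfA)
  qed
  have Af: "(A *v f y) \<bullet> z = (A *v f y) \<bullet> (A *v f z)" for y z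
  proof -
    have "(A *v f y) \<bullet> z = f y \<bullet> (z v* A)"
      by (metis dot_lmul_matrix inner_commute)
    also have "\<dots> = f y \<bullet> ((A *v f z) v* A)"
      by (simp add: f)
    also have "\<dots> = (A *v f y) \<bullet> (A *v f z)"
      by (metis dot_lmul_matrix inner_commute)
    finally show ?thesis .
  qed
  have "is_moore_penrose_inverse A (matrix f)"
    unfolding is_moore_penrose_inverse_def
  proof (intro conjI)
    show "A ** matrix f ** A = A"
      by (simp add: matrix_eq matrix_vector_mul_assoc[symmetric] X AfA)
    show "matrix f ** A ** matrix f = matrix f"
      by (simp add: matrix_eq matrix_vector_mul_assoc[symmetric] X f_unique[OF fW refl, symmetric])
    show "transpose (A ** matrix f) = A ** matrix f"
    proof (rule symmetricI)
      fix x y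
      show "((A ** matrix f) *v x) \<bullet> y = x \<bullet> ((A ** matrix f) *v y)"
        using Af[of x y] Af[of y x]
        by (simp add: matrix_vector_mul_assoc[symmetric] X inner_commute)
    qed
    show "transpose (matrix f ** A) = matrix f ** A"
    proof (rule symmetricI)
      fix x y
      show "((matrix f ** A) *v x) \<bullet> y = x \<bullet> ((matrix f ** A) *v y)"
        using fA[of x y] fA[of y x]
        by (simp add: matrix_vector_mul_assoc[symmetric] X inner_commute)
    qed
  qed
  then show ?thesis ..
qed

lemma moore_penrose_inverse_unique:
  fixes A :: "real^'n^'m"
  assumes X: "is_moore_penrose_inverse A X" and Y: "is_moore_penrose_inverse A Y"
  shows "X = Y"
proof -
  note mp = X[unfolded is_moore_penrose_inverse_def] Y[unfolded is_moore_penrose_inverse_def]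
  have "A ** Y = transpose (A ** X ** A ** Y)"
    using mp by (simp add: matrix_mul_assoc)
  also have "\<dots> = transpose (A ** Y) ** transpose (A ** X)"
    by (simp add: matrix_transpose_mul matrix_mul_assoc)
  also have "\<dots> = A ** Y ** (A ** X)"
    using mp by simp
  also have "\<dots> = A ** X"
    using mp by (simp add: matrix_mul_assoc)
  finally have AX: "A ** Y = A ** X" .
  have "Y ** A = transpose (Y ** (A ** X ** A))"
    using mp by simp
  also have "\<dots> = transpose ((Y ** A) ** (X ** A))"
    by (simp add: matrix_mul_assoc)
  also have "\<dots> = X ** A ** (Y ** A)"
    using mp by (simp add: matrix_transpose_mul)
  also have "\<dots> = X ** (A ** Y ** A)"
    by (simp add: matrix_mul_assoc)
  also have "\<dots> = X ** A"
    using mp by simp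
  finally have XA: "Y ** A = X ** A" .
  have "X = X ** (A ** X)"
    using mp by (simp add: matrix_mul_assoc)
  also have "\<dots> = Y ** A ** Y"
    by (simp add: AX[symmetric] XA matrix_mul_assoc)
  finally show ?thesis
    using mp by simp
qed

lemma pinv_is_moore_penrose_inverse: "is_moore_penrose_inverse A (pinv A)"
  unfolding pinv_def
  using moore_penrose_inverse_exists moore_penrose_inverse_unique by (metis theI')

text \<open>The point \<open>xs\<close> is the orthogonal projection of \<open>x\<close> onto the solution set, whose directions
  form the orthogonal complement of the row space.\<close>

lemma pinv_affine_solution:
  fixes A :: "real^'n^'m"
  assumes consistent: "\<exists>x. A *v x = b"
    and xs: "xs = pinv A *v b + (mat 1 - pinv A ** A) *v x"
  shows "A *v xs = b" and "x - xs \<in> row_space A"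
proof -
  obtain y where y: "A *v y = b"
    using consistent ..
  have mp: "A ** pinv A ** A = A" "transpose (pinv A ** A) = pinv A ** A"
    using pinv_is_moore_penrose_inverse[of A] by (simp_all add: is_moore_penrose_inverse_def)
  have diff: "x - xs = (pinv A ** A) *v (x - y)"
    by (simp add: xs y[symmetric] matrix_vector_mul_assoc[symmetric] matrix_vector_mult_diff_distrib
        matrix_vector_mult_diff_rdistrib)
  then have "A *v (x - xs) = A *v (x - y)"
    by (metis matrix_mul_assoc matrix_vector_mul_assoc mp(1))
  then show "A *v xs = b"
    by (simp add: y matrix_vector_mult_diff_distrib)
  have "x - xs = transpose (pinv A ** A) *v (x - y)"
    by (simp only: diff mp(2))
  also have "\<dots> = ((x - y) v* pinv A) v* A"
    by (metis matrix_transpose_mul matrix_vector_mul_assoc transpose_matrix_vector)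
  finally show "x - xs \<in> row_space A"
    by simp
qed

section \<open>The smallest nonzero singular value\<close>

lemma singular_value_vector:
  "s \<in> singular_values A \<longleftrightarrow> 0 \<le> s \<and> (\<exists>v. v \<noteq> 0 \<and> (A *v v) v* A = s\<^sup>2 *\<^sub>R v)"
  by (simp add: singular_values_def matrix_vector_mul_assoc[symmetric])

lemma gram_inner: "((A *v u) v* A) \<bullet> v = (A *v u) \<bullet> (A *v v)" for A :: "real^'n^'m"
  by (rule dot_lmul_matrix)

text \<open>Eigenvectors of the symmetric Gram matrix for different eigenvalues are orthogonal, and a
  Euclidean space contains only finitely many pairwise orthogonal nonzero vectors.\<close>

lemma finite_singular_values: "finite (singular_values (A :: real^'n^'m))"
proof -
  have "\<forall>s\<in>singular_values A. \<exists>v. v \<noteq> 0 \<and> (A *v v) v* A = s\<^sup>2 *\<^sub>R v"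
    by (simp add: singular_value_vector)
  then obtain g where g0: "\<And>s. s \<in> singular_values A \<Longrightarrow> g s \<noteq> 0"
    and g: "\<And>s. s \<in> singular_values A \<Longrightarrow> (A *v g s) v* A = s\<^sup>2 *\<^sub>R g s"
    by metis
  have orth: "g s \<bullet> g t = 0" if "s \<in> singular_values A" "t \<in> singular_values A" "s \<noteq> t" for s t
  proof -
    have "s\<^sup>2 * (g s \<bullet> g t) = t\<^sup>2 * (g s \<bullet> g t)"
      using gram_inner[of A "g s" "g t"] gram_inner[of A "g t" "g s"] that
      by (simp add: g inner_commute)
    moreover have "s\<^sup>2 \<noteq> t\<^sup>2"
      using that by (auto simp: singular_value_vector power2_eq_iff)
    ultimately show ?thesis by simp
  qed
  have "pairwise orthogonal (g ` singular_values A)"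
    using orth by (auto simp: pairwise_def orthogonal_def)
  moreover have "inj_on g (singular_values A)"
    using orth g0 by (metis inj_onI inner_eq_zero_iff)
  ultimately show ?thesis
    using pairwise_orthogonal_imp_finite finite_imageD by blast
qed

lemma norm_add_scaleR_squared:
  "(norm (v + e *\<^sub>R h))\<^sup>2 = (norm v)\<^sup>2 + 2 * e * (v \<bullet> h) + e\<^sup>2 * (norm h)\<^sup>2"
  using dot_norm[of v "e *\<^sub>R h"] by (simp add: power_mult_distrib)

text \<open>By compactness \<open>norm (A *v v)\<close> attains its minimum over the unit sphere of the row space. There
  the first variation vanishes in all directions of the row space, and the residual \<open>h\<close> of the
  eigenvalue equation is itself such a direction; so the minimiser is an eigenvector of the Gram
  matrix. The minimum is positive because the row space meets the kernel trivially.\<close>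

lemma minimal_gram_eigenvector:
  fixes A :: "real^'n^'m"
  assumes "rank A > 0"
  obtains l where "l > 0" "sqrt l \<in> singular_values A"
    "\<And>v. v \<in> row_space A \<Longrightarrow> l * (norm v)\<^sup>2 \<le> (norm (A *v v))\<^sup>2"
proof -
  let ?S = "row_space A \<inter> sphere 0 1"
  have W: "subspace (row_space A)"
    by (rule subspace_row_space)
  have "compact ?S"
    using closed_subspace[OF W] by (intro closed_Int_compact compact_sphere)
  moreover have "?S \<noteq> {}"
  proof -
    obtain v where "v \<in> row_space A" "v \<noteq> 0"
      using row_space_nontrivial[OF assms] by blast
    then have "(1 / norm v) *\<^sub>R v \<in> ?S"
      by (simp add: subspace_scale[OF W])
    then show ?thesis by blast
  qed
  moreover have "continuous_on ?S (\<lambda>v. (norm (A *v v))\<^sup>2)"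
    by (intro continuous_intros linear_continuous_on linear_conv_bounded_linear[THEN iffD1]
        matrix_vector_mul_linear)
  ultimately obtain v where v: "v \<in> ?S"
    and vmin: "\<And>u. u \<in> ?S \<Longrightarrow> (norm (A *v v))\<^sup>2 \<le> (norm (A *v u))\<^sup>2"
    using continuous_attains_inf[of ?S "\<lambda>v. (norm (A *v v))\<^sup>2"] by blast
  define l where "l = (norm (A *v v))\<^sup>2"
  have vW: "v \<in> row_space A" and v1: "norm v = 1"
    using v by auto
  have l0: "l > 0"
    using row_space_kernel_trivial[OF vW] v1 by (auto simp: l_def)
  have lower: "l * (norm u)\<^sup>2 \<le> (norm (A *v u))\<^sup>2" if u: "u \<in> row_space A" for u
  proof (cases "u = 0")
    case False
    have "l \<le> (norm (A *v ((1 / norm u) *\<^sub>R u)))\<^sup>2"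
      unfolding l_def by (rule vmin) (simp add: False subspace_scale[OF W] u)
    also have "\<dots> = (norm (A *v u))\<^sup>2 / (norm u)\<^sup>2"
      by (simp add: matrix_vector_mult_scaleR power_divide)
    finally show ?thesis
      using False by (simp add: pos_le_divide_eq)
  qed simp
  define h where "h = (A *v v) v* A - l *\<^sub>R v"
  have hW: "h \<in> row_space A"
    unfolding h_def by (intro subspace_diff[OF W] subspace_scale[OF W] vW) auto
  have h_inner: "(A *v v) \<bullet> (A *v u) - l * (v \<bullet> u) = h \<bullet> u" for u
    by (simp add: h_def inner_diff_left gram_inner)
  define C where "C = (norm (A *v h))\<^sup>2 - l * (norm h)\<^sup>2"
  have variation: "0 \<le> 2 * e * (norm h)\<^sup>2 + e\<^sup>2 * C" for e
  proof -
    have "0 \<le> (norm (A *v (v + e *\<^sub>R h)))\<^sup>2 - l * (norm (v + e *\<^sub>R h))\<^sup>2"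
      using lower[of "v + e *\<^sub>R h"] by (simp add: subspace_add[OF W] subspace_scale[OF W] vW hW)
    also have "(norm (A *v (v + e *\<^sub>R h)))\<^sup>2
        = l + 2 * e * ((A *v v) \<bullet> (A *v h)) + e\<^sup>2 * (norm (A *v h))\<^sup>2"
      by (simp add: l_def matrix_vector_right_distrib matrix_vector_mult_scaleR
          norm_add_scaleR_squared)
    also have "(norm (v + e *\<^sub>R h))\<^sup>2 = 1 + 2 * e * (v \<bullet> h) + e\<^sup>2 * (norm h)\<^sup>2"
      using v1 by (simp add: norm_add_scaleR_squared)
    also have "l + 2 * e * ((A *v v) \<bullet> (A *v h)) + e\<^sup>2 * (norm (A *v h))\<^sup>2
          - l * (1 + 2 * e * (v \<bullet> h) + e\<^sup>2 * (norm h)\<^sup>2)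
        = 2 * e * ((A *v v) \<bullet> (A *v h) - l * (v \<bullet> h)) + e\<^sup>2 * C"
      by (simp add: C_def algebra_simps)
    also have "(A *v v) \<bullet> (A *v h) - l * (v \<bullet> h) = (norm h)\<^sup>2"
      by (simp add: h_inner power2_norm_eq_inner)
    finally show ?thesis .
  qed
  have C0: "0 \<le> C"
    using lower[OF hW] by (simp add: C_def)
  have "(norm h)\<^sup>2 = 0"
  proof (rule ccontr)
    assume "(norm h)\<^sup>2 \<noteq> 0"
    then have pos: "(norm h)\<^sup>2 > 0" by simp
    \<comment> \<open>This step size makes the linear term outweigh the quadratic one.\<close>
    define e where "e = - (norm h)\<^sup>2 / (C + 1)"
    have e0: "e < 0"
      using pos C0 by (simp add: e_def field_simps)
    have "e * C = - (norm h)\<^sup>2 - e"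
      using C0 by (simp add: e_def field_simps)
    then have "2 * e * (norm h)\<^sup>2 + e\<^sup>2 * C = e * ((norm h)\<^sup>2 - e)"
      by (simp add: power2_eq_square[of e] right_diff_distrib mult.assoc)
    also have "\<dots> < 0"
      using e0 pos by (intro mult_neg_pos) linarith+
    finally have "2 * e * (norm h)\<^sup>2 + e\<^sup>2 * C < 0" .
    with variation[of e] show False by simp
  qed
  then have "(A *v v) v* A = l *\<^sub>R v"
    by (simp add: h_def)
  then have "sqrt l \<in> singular_values A"
    unfolding singular_value_vector using l0 v1 by (intro conjI exI[of _ v]) auto
  with l0 lower show ?thesis
    using that by blast
qed

text \<open>The minimum over the unit sphere is the square of some nonzero singular value and hence at least
  that of the smallest one; finiteness of their set makes \<open>Min\<close> a genuine minimum.\<close>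

lemma sigma_min_lower_bound:
  fixes A :: "real^'n^'m"
  assumes "rank A > 0" "v \<in> row_space A"
  shows "(sigma_min A)\<^sup>2 * (norm v)\<^sup>2 \<le> (norm (A *v v))\<^sup>2"
proof -
  obtain l where l: "l > 0" "sqrt l \<in> singular_values A"
    "l * (norm v)\<^sup>2 \<le> (norm (A *v v))\<^sup>2"
    using minimal_gram_eigenvector[OF assms(1)] assms(2) by metis
  have mem: "sqrt l \<in> singular_values A - {0}"
    using l by simp
  have fin: "finite (singular_values A - {0})"
    using finite_singular_values by blast
  have "sigma_min A \<le> sqrt l"
    unfolding sigma_min_def using Min_le[OF fin mem] .
  moreover have "sigma_min A \<in> singular_values A"
    using Min_in[OF fin] mem unfolding sigma_min_def by blast
  ultimately have "(sigma_min A)\<^sup>2 \<le> l"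
    using l(1) power_mono[of "sigma_min A" "sqrt l" 2] by (simp add: singular_value_vector)
  then show ?thesis
    using l(3) mult_right_mono[of "(sigma_min A)\<^sup>2" l "(norm v)\<^sup>2"] by simp
qed

text \<open>By Bessel's inequality in every row, two orthonormal vectors together capture at most the
  squared Frobenius norm.\<close>

lemma two_orthonormal_bound:
  fixes A :: "real^'n^'m"
  assumes "norm u = 1" "norm v = 1" "u \<bullet> v = 0"
  shows "(norm (A *v u))\<^sup>2 + (norm (A *v v))\<^sup>2 \<le> (norm A)\<^sup>2"
proof -
  have bessel: "(a \<bullet> u)\<^sup>2 + (a \<bullet> v)\<^sup>2 \<le> (norm a)\<^sup>2" for a
  proof -
    have uv: "u \<bullet> u = 1" "v \<bullet> v = 1"
      using assms by (simp_all add: norm_eq_1)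
    have "0 \<le> (norm (a - (a \<bullet> u) *\<^sub>R u - (a \<bullet> v) *\<^sub>R v))\<^sup>2"
      by simp
    also have "\<dots> = (norm a)\<^sup>2 - (a \<bullet> u)\<^sup>2 - (a \<bullet> v)\<^sup>2"
      unfolding power2_norm_eq_inner using assms(3)
      by (simp add: inner_diff_left inner_diff_right inner_commute uv power2_eq_square algebra_simps)
    finally show ?thesis by simp
  qed
  have sq: "(norm x)\<^sup>2 = (\<Sum>i\<in>UNIV. (norm (x $ i))\<^sup>2)" for x :: "'a::real_inner^'m"
    by (simp add: norm_vec_def L2_set_def sum_nonneg)
  show ?thesis
    unfolding sq sum.distrib[symmetric] matrix_mult_dot
    by (rule sum_mono) (simp add: bessel)
qed

text \<open>Here rank at least two is essential: it supplies a unit vector \<open>u\<close> of the row space orthogonal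
  to \<open>v\<close>. Since \<open>u\<close> already uses up at least the squared smallest nonzero singular value, no more
  than the remainder of the squared Frobenius norm is left for \<open>v\<close>.\<close>

lemma gram_upper_bound:
  fixes A :: "real^'n^'m"
  assumes rank: "rank A \<ge> 2" and v: "v \<in> row_space A"
  shows "(norm (A *v v))\<^sup>2 \<le> ((norm A)\<^sup>2 - (sigma_min A)\<^sup>2) * (norm v)\<^sup>2"
proof (cases "v = 0")
  case False
  have W: "subspace (row_space A)"
    by (rule subspace_row_space)
  have "span {v} \<subseteq> span (row_space A)"
    using v by (intro span_mono) auto
  moreover have "dim (span {v}) < dim (span (row_space A))"
    using rank False dim_row_space[of A] dim_insert[of v "{}"] by (simp add: dim_span)
  ultimately have "span {v} \<subset> span (row_space A)"
    by (metis psubsetI less_irrefl)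
  then obtain u where u: "u \<noteq> 0" "u \<in> span (row_space A)" and uv: "u \<bullet> v = 0"
    using orthogonal_to_subspace_exists_gen[of "{v}" "row_space A"]
    by (metis orthogonal_def span_base singletonI)
  have uW: "u \<in> row_space A"
    using u(2) span_eq_iff[THEN iffD2, OF W] by simp
  let ?u = "(1 / norm u) *\<^sub>R u" and ?v = "(1 / norm v) *\<^sub>R v"
  have "(sigma_min A)\<^sup>2 \<le> (norm (A *v ?u))\<^sup>2"
    using sigma_min_lower_bound[of A ?u] rank u(1) by (simp add: subspace_scale[OF W] uW)
  moreover have "(norm (A *v ?u))\<^sup>2 + (norm (A *v ?v))\<^sup>2 \<le> (norm A)\<^sup>2"
    by (rule two_orthonormal_bound) (use u(1) False uv in auto)
  ultimately have "(norm (A *v ?v))\<^sup>2 \<le> (norm A)\<^sup>2 - (sigma_min A)\<^sup>2"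
    by simp
  also have "(norm (A *v ?v))\<^sup>2 = (norm (A *v v))\<^sup>2 / (norm v)\<^sup>2"
    by (simp add: matrix_vector_mult_scaleR power_divide)
  finally show ?thesis
    using False by (simp add: pos_divide_le_eq)
qed simp

section \<open>The expected reflection\<close>

text \<open>A symmetric operator whose quadratic form is bounded by \<open>t\<close> in absolute value has norm at
  most \<open>t\<close>: polarise \<open>T v \<bullet> w\<close> with \<open>w\<close> the multiple of \<open>T v\<close> that has the length of \<open>v\<close>.\<close>

lemma symmetric_form_bound_imp_norm_bound:
  fixes T :: "'a::real_inner \<Rightarrow> 'a"
  assumes "linear T" and W: "subspace W" and TW: "\<And>v. v \<in> W \<Longrightarrow> T v \<in> W"
    and sym: "\<And>u v. T u \<bullet> v = u \<bullet> T v"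
    and form: "\<And>v. v \<in> W \<Longrightarrow> \<bar>T v \<bullet> v\<bar> \<le> t * (norm v)\<^sup>2"
    and v: "v \<in> W"
  shows "norm (T v) \<le> t * norm v"
proof (cases "T v = 0 \<or> v = 0")
  case True
  then show ?thesis
    using form[OF v] linear_0[OF assms(1)]
    by (cases "v = 0") (auto simp: zero_le_mult_iff)
next
  case False
  define w where "w = (norm v / norm (T v)) *\<^sub>R T v"
  have w: "w \<in> W" "norm w = norm v"
    using False by (simp_all add: w_def subspace_scale[OF W] TW v)
  have "T v \<bullet> w = norm v * norm (T v)"
    using False by (simp add: w_def dot_square_norm power2_eq_square)
  then have "4 * (norm v * norm (T v)) = 4 * (T v \<bullet> w)"
    by simp
  also have "\<dots> = T (v + w) \<bullet> (v + w) - T (v - w) \<bullet> (v - w)"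
    using sym[of w v]
    by (simp add: linear_add[OF assms(1)] linear_diff[OF assms(1)] inner_add_left inner_add_right
        inner_diff_left inner_diff_right inner_commute)
  also have "\<dots> \<le> t * (norm (v + w))\<^sup>2 + t * (norm (v - w))\<^sup>2"
    using form[of "v + w"] form[of "v - w"] subspace_add[OF W v w(1)] subspace_diff[OF W v w(1)]
    by linarith
  also have "\<dots> = 2 * t * ((norm v)\<^sup>2 + (norm w)\<^sup>2)"
    unfolding power2_norm_eq_inner
    by (simp add: inner_add_left inner_add_right inner_diff_left inner_diff_right algebra_simps)
  also have "\<dots> = 4 * (norm v * (t * norm v))"
    by (simp add: w(2) power2_eq_square)
  finally have "norm v * norm (T v) \<le> norm v * (t * norm v)"
    by simp
  then show ?thesis
    using False by simp
qed

text \<open>The expected linear part of the reflection in the hyperplane of a row that is drawn with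
  probability proportional to its squared norm.\<close>

definition mean_reflection :: "real^'n^'m \<Rightarrow> real^'n \<Rightarrow> real^'n" where
  "mean_reflection A v = v - (2 / (norm A)\<^sup>2) *\<^sub>R ((A *v v) v* A)"

lemma linear_mean_reflection: "linear (mean_reflection A)"
  by (rule linearI)
    (simp_all add: mean_reflection_def matrix_vector_right_distrib matrix_vector_mult_scaleR
      linear_add[OF linear_vector_matrix_mult] linear_scale[OF linear_vector_matrix_mult]
      algebra_simps)

lemma mean_reflection_row_space: "v \<in> row_space A \<Longrightarrow> mean_reflection A v \<in> row_space A"
  unfolding mean_reflection_def
  by (intro subspace_diff subspace_scale subspace_row_space) auto

lemma mean_reflection_symmetric: "mean_reflection A u \<bullet> v = u \<bullet> mean_reflection A v"
proof -
  have "u \<bullet> ((A *v v) v* A) = (A *v u) \<bullet> (A *v v)"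
    by (metis gram_inner inner_commute)
  then show ?thesis
    by (simp add: mean_reflection_def inner_diff_left inner_diff_right gram_inner)
qed

text \<open>The eigenvalues of the operator on the row space are \<open>1 - 2 * s\<close>, where the lower and the upper
  bound of the Gram form confine \<open>s\<close> to an interval that is symmetric about one half. So the single
  constant \<open>t\<close> bounds them from both sides, which controls even and odd powers of the operator
  alike.\<close>

lemma mean_reflection_contraction:
  fixes A :: "real^'n^'m"
  assumes rank: "rank A \<ge> 2"
  defines "t \<equiv> 1 - 2 * ((sigma_min A)\<^sup>2 / (norm A)\<^sup>2)"
  shows "v \<in> row_space A \<Longrightarrow> norm (mean_reflection A v) \<le> t * norm v" and "0 \<le> t"
proof -
  have A0: "(norm A)\<^sup>2 > 0"
    using rank rank_0 by fastforce
  have form: "\<bar>mean_reflection A u \<bullet> u\<bar> \<le> t * (norm u)\<^sup>2" if u: "u \<in> row_space A" for u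
  proof -
    have eq: "mean_reflection A u \<bullet> u = (norm u)\<^sup>2 - 2 * ((norm (A *v u))\<^sup>2 / (norm A)\<^sup>2)"
      by (simp add: mean_reflection_def inner_diff_left gram_inner power2_norm_eq_inner)
    have lo: "(sigma_min A)\<^sup>2 / (norm A)\<^sup>2 * (norm u)\<^sup>2 \<le> (norm (A *v u))\<^sup>2 / (norm A)\<^sup>2"
      using sigma_min_lower_bound[of A u] rank u A0 by (simp add: divide_right_mono)
    have "(norm (A *v u))\<^sup>2 / (norm A)\<^sup>2
        \<le> ((norm A)\<^sup>2 - (sigma_min A)\<^sup>2) * (norm u)\<^sup>2 / (norm A)\<^sup>2"
      using gram_upper_bound[OF rank u] by (simp add: divide_right_mono)
    also have "\<dots> = (norm u)\<^sup>2 - (sigma_min A)\<^sup>2 / (norm A)\<^sup>2 * (norm u)\<^sup>2"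
      using A0 by (simp add: field_simps)
    finally show ?thesis
      using lo unfolding eq t_def by (simp add: algebra_simps abs_le_iff)
  qed
  show "v \<in> row_space A \<Longrightarrow> norm (mean_reflection A v) \<le> t * norm v"
    by (rule symmetric_form_bound_imp_norm_bound[OF linear_mean_reflection subspace_row_space
          mean_reflection_row_space mean_reflection_symmetric form])
  obtain u where u: "u \<in> row_space A" "u \<noteq> 0"
    using row_space_nontrivial[of A] rank by auto
  have "0 \<le> t * (norm u)\<^sup>2"
    using form[OF u(1)] by linarith
  then show "0 \<le> t"
    using u(2) by (simp add: zero_le_mult_iff)
qed

lemma mean_reflection_power_symmetric:
  "(mean_reflection A ^^ r) u \<bullet> v = u \<bullet> (mean_reflection A ^^ r) v"
proof (induction r arbitrary: u v)
  case (Suc r)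
  have "(mean_reflection A ^^ Suc r) u \<bullet> v = (mean_reflection A ^^ r) u \<bullet> mean_reflection A v"
    by (simp add: mean_reflection_symmetric)
  also have "\<dots> = u \<bullet> (mean_reflection A ^^ Suc r) v"
    by (simp only: Suc.IH funpow_Suc_right o_apply)
  finally show ?case .
qed simp

text \<open>Invariance of the row space is carried through the induction, since the contraction holds
  only there.\<close>

lemma mean_reflection_power_contraction:
  fixes A :: "real^'n^'m"
  assumes rank: "rank A \<ge> 2" and v: "v \<in> row_space A"
  defines "t \<equiv> 1 - 2 * ((sigma_min A)\<^sup>2 / (norm A)\<^sup>2)"
  shows "(mean_reflection A ^^ r) v \<in> row_space A \<and> norm ((mean_reflection A ^^ r) v) \<le> t ^ r * norm v"
proof (induction r)
  case (Suc r)
  let ?w = "(mean_reflection A ^^ r) v"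
  have "norm (mean_reflection A ?w) \<le> t * norm ?w"
    unfolding t_def using Suc by (intro mean_reflection_contraction(1)[OF rank]) auto
  also have "\<dots> \<le> t * (t ^ r * norm v)"
    using Suc mean_reflection_contraction(2)[OF rank] by (simp add: t_def mult_left_mono)
  finally show ?case
    using Suc by (simp add: mean_reflection_row_space mult.assoc)
qed (simp add: v)

section \<open>Expectations under independent row selections\<close>

text \<open>A variable that depends on finitely many selections takes finitely many values. Making the
  dependence on the set \<open>K\<close> of selections explicit is what allows independence to be applied.\<close>

lemma (in prob_space) integrable_finite_history:
  fixes J :: "'i \<Rightarrow> 'a \<Rightarrow> 'm::finite" and F :: "('i \<Rightarrow> 'm) \<Rightarrow> 'b::euclidean_space"
  assumes J: "\<And>i. i \<in> K \<Longrightarrow> random_variable (count_space UNIV) (J i)" and K: "finite K"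
    and dep: "\<And>f g. (\<And>i. i \<in> K \<Longrightarrow> f i = g i) \<Longrightarrow> F f = F g"
  shows "integrable M (\<lambda>\<omega>. F (\<lambda>i. J i \<omega>))"
proof -
  have F_eq: "(\<lambda>\<omega>. F (\<lambda>i. J i \<omega>)) = (\<lambda>\<omega>. F (\<lambda>i\<in>K. J i \<omega>))"
    by (intro ext dep) simp
  have meas: "(\<lambda>\<omega>. \<lambda>i\<in>K. J i \<omega>) \<in> M \<rightarrow>\<^sub>M count_space (PiE K (\<lambda>_. UNIV))"
    using measurable_restrict[of K J M "\<lambda>_. count_space UNIV"] J K
    by (simp add: count_space_PiM_finite)
  obtain B where B: "\<And>h. h \<in> PiE K (\<lambda>_. UNIV) \<Longrightarrow> norm (F h) \<le> B"
    using finite_imp_bounded[OF finite_imageI[OF finite_PiE[OF K, of "\<lambda>_. UNIV"], of F]]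
    by (auto simp: bounded_iff)
  show ?thesis
    unfolding F_eq
  proof (rule integrable_const_bound)
    show "AE \<omega> in M. norm (F (\<lambda>i\<in>K. J i \<omega>)) \<le> B"
      by (intro AE_I2 B) auto
    show "(\<lambda>\<omega>. F (\<lambda>i\<in>K. J i \<omega>)) \<in> borel_measurable M"
      by (rule measurable_compose[OF meas]) simp
  qed
qed

lemma (in prob_space) expectation_fresh_selection_indicator:
  fixes J :: "'i \<Rightarrow> 'a \<Rightarrow> 'm::finite" and F :: "('i \<Rightarrow> 'm) \<Rightarrow> 'b::euclidean_space"
  assumes ind: "indep_vars (\<lambda>_. count_space UNIV) J I"
    and K: "finite K" "K \<subseteq> I" and j: "j \<in> I" "j \<notin> K"
    and dep: "\<And>f g. (\<And>i. i \<in> K \<Longrightarrow> f i = g i) \<Longrightarrow> F f = F g"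
  shows "expectation (\<lambda>\<omega>. of_bool (J j \<omega> = i) *\<^sub>R F (\<lambda>i. J i \<omega>))
      = prob {\<omega> \<in> space M. J j \<omega> = i} *\<^sub>R expectation (\<lambda>\<omega>. F (\<lambda>i. J i \<omega>))"
    and "integrable M (\<lambda>\<omega>. of_bool (J j \<omega> = i) *\<^sub>R F (\<lambda>i. J i \<omega>))"
proof -
  have rv: "random_variable (count_space UNIV) (J i)" if "i \<in> I" for i
    using ind that by (simp add: indep_vars_def)
  have int: "integrable M (\<lambda>\<omega>. G (\<lambda>i. J i \<omega>))"
    if "\<And>f g. (\<And>i. i \<in> L \<Longrightarrow> f i = g i) \<Longrightarrow> G f = G g" "finite L" "L \<subseteq> I"
    for L and G :: "('i \<Rightarrow> 'm) \<Rightarrow> 'c::euclidean_space"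
    by (rule integrable_finite_history[OF rv that(2,1)]) (use that(3) in auto)
  have intF: "integrable M (\<lambda>\<omega>. F (\<lambda>i. J i \<omega>))"
    using int[of K F] dep K by blast
  show intiF: "integrable M (\<lambda>\<omega>. of_bool (J j \<omega> = i) *\<^sub>R F (\<lambda>i. J i \<omega>))"
  proof (rule int[of "insert j K" "\<lambda>f. of_bool (f j = i) *\<^sub>R F f"])
    fix f g :: "'i \<Rightarrow> 'm"
    assume "\<And>i. i \<in> insert j K \<Longrightarrow> f i = g i"
    then show "of_bool (f j = i) *\<^sub>R F f = of_bool (g j = i) *\<^sub>R F g"
      using dep[of f g] by simp
  qed (use K j in auto)
  have inti: "integrable M (\<lambda>\<omega>. of_bool (J j \<omega> = i) :: real)"
    by (rule int[of "{j}" "\<lambda>f. of_bool (f j = i)"]) (use j in auto)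
  have prob: "expectation (\<lambda>\<omega>. of_bool (J j \<omega> = i)) = prob {\<omega> \<in> space M. J j \<omega> = i}"
  proof -
    have "expectation (\<lambda>\<omega>. of_bool (J j \<omega> = i))
        = expectation (indicator {\<omega> \<in> space M. J j \<omega> = i} :: 'a \<Rightarrow> real)"
      by (intro Bochner_Integration.integral_cong) (auto simp: indicator_def)
    also have "{\<omega> \<in> space M. J j \<omega> = i} \<inter> space M = {\<omega> \<in> space M. J j \<omega> = i}"
      by blast
    then have "expectation (indicator {\<omega> \<in> space M. J j \<omega> = i} :: 'a \<Rightarrow> real)
        = prob {\<omega> \<in> space M. J j \<omega> = i}"
      by simp
    finally show ?thesis .
  qed
  \<comment> \<open>Independence factorises products of scalar variables; hence one coordinate at a time.\<close>
  have coord: "expectation (\<lambda>\<omega>. of_bool (J j \<omega> = i) * (F (\<lambda>i. J i \<omega>) \<bullet> u))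
      = prob {\<omega> \<in> space M. J j \<omega> = i} * expectation (\<lambda>\<omega>. F (\<lambda>i. J i \<omega>) \<bullet> u)" for u
  proof -
    have "indep_var (PiM {j} (\<lambda>_. count_space UNIV)) (\<lambda>\<omega>. \<lambda>i\<in>{j}. J i \<omega>)
        (PiM K (\<lambda>_. count_space UNIV)) (\<lambda>\<omega>. \<lambda>i\<in>K. J i \<omega>)"
      using K j by (intro indep_var_restrict[OF ind]) auto
    then have "indep_var borel ((\<lambda>h. of_bool (h j = i) :: real) \<circ> (\<lambda>\<omega>. \<lambda>i\<in>{j}. J i \<omega>))
        borel ((\<lambda>h. F h \<bullet> u) \<circ> (\<lambda>\<omega>. \<lambda>i\<in>K. J i \<omega>))"
      by (rule indep_var_compose) (simp_all add: count_space_PiM_finite K)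
    moreover have "(\<lambda>h. F h \<bullet> u) \<circ> (\<lambda>\<omega>. \<lambda>i\<in>K. J i \<omega>) = (\<lambda>\<omega>. F (\<lambda>i. J i \<omega>) \<bullet> u)"
      unfolding o_def by (intro ext arg_cong2[where f = inner] dep) auto
    moreover have "(\<lambda>h. of_bool (h j = i) :: real) \<circ> (\<lambda>\<omega>. \<lambda>i\<in>{j}. J i \<omega>)
        = (\<lambda>\<omega>. of_bool (J j \<omega> = i))"
      by (simp add: o_def)
    ultimately show ?thesis
      using indep_var_lebesgue_integral[of "\<lambda>\<omega>. of_bool (J j \<omega> = i)" "\<lambda>\<omega>. F (\<lambda>i. J i \<omega>) \<bullet> u"]
        inti intF by (simp add: prob)
  qed
  show "expectation (\<lambda>\<omega>. of_bool (J j \<omega> = i) *\<^sub>R F (\<lambda>i. J i \<omega>))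
      = prob {\<omega> \<in> space M. J j \<omega> = i} *\<^sub>R expectation (\<lambda>\<omega>. F (\<lambda>i. J i \<omega>))"
  proof (rule euclidean_eqI)
    fix u :: 'b
    have "expectation (\<lambda>\<omega>. of_bool (J j \<omega> = i) *\<^sub>R F (\<lambda>i. J i \<omega>)) \<bullet> u
        = expectation (\<lambda>\<omega>. (of_bool (J j \<omega> = i) *\<^sub>R F (\<lambda>i. J i \<omega>)) \<bullet> u)"
      by (rule integral_inner_left[symmetric]) (rule intiF)
    also have "\<dots> = prob {\<omega> \<in> space M. J j \<omega> = i} * expectation (\<lambda>\<omega>. F (\<lambda>i. J i \<omega>) \<bullet> u)"
      using coord by simp
    also have "expectation (\<lambda>\<omega>. F (\<lambda>i. J i \<omega>) \<bullet> u) = expectation (\<lambda>\<omega>. F (\<lambda>i. J i \<omega>)) \<bullet> u"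
      by (rule integral_inner_left) (rule intF)
    finally show "expectation (\<lambda>\<omega>. of_bool (J j \<omega> = i) *\<^sub>R F (\<lambda>i. J i \<omega>)) \<bullet> u
        = (prob {\<omega> \<in> space M. J j \<omega> = i} *\<^sub>R expectation (\<lambda>\<omega>. F (\<lambda>i. J i \<omega>))) \<bullet> u"
      by simp
  qed
qed

text \<open>Splitting according to the value of the fresh selection leaves, for each value \<open>i\<close>, the function
  \<open>G i\<close> composed with \<open>F\<close>, which depends again only on the selections in \<open>K\<close>.\<close>

lemma (in prob_space) expectation_fresh_selection:
  fixes J :: "'i \<Rightarrow> 'a \<Rightarrow> 'm::finite" and F :: "('i \<Rightarrow> 'm) \<Rightarrow> 'b::euclidean_space"
    and G :: "'m \<Rightarrow> 'b \<Rightarrow> 'c::euclidean_space"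
  assumes ind: "indep_vars (\<lambda>_. count_space UNIV) J I"
    and K: "finite K" "K \<subseteq> I" and j: "j \<in> I" "j \<notin> K"
    and dep: "\<And>f g. (\<And>i. i \<in> K \<Longrightarrow> f i = g i) \<Longrightarrow> F f = F g"
  shows "expectation (\<lambda>\<omega>. G (J j \<omega>) (F (\<lambda>i. J i \<omega>)))
      = (\<Sum>i\<in>UNIV. prob {\<omega> \<in> space M. J j \<omega> = i} *\<^sub>R expectation (\<lambda>\<omega>. G i (F (\<lambda>i. J i \<omega>))))"
proof -
  have dep': "G i (F f) = G i (F g)" if "\<And>i. i \<in> K \<Longrightarrow> f i = g i" for i f g
    using dep[OF that] by simp
  note fresh = expectation_fresh_selection_indicator[OF ind K j, of "\<lambda>f. G i (F f)" i for i, OF dep']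
  have "expectation (\<lambda>\<omega>. G (J j \<omega>) (F (\<lambda>i. J i \<omega>)))
      = expectation (\<lambda>\<omega>. \<Sum>i\<in>UNIV. of_bool (J j \<omega> = i) *\<^sub>R G i (F (\<lambda>i. J i \<omega>)))"
    by (simp add: of_bool_def if_distrib[of "\<lambda>c. c *\<^sub>R _"] cong: if_cong)
  also have "\<dots> = (\<Sum>i\<in>UNIV. expectation (\<lambda>\<omega>. of_bool (J j \<omega> = i) *\<^sub>R G i (F (\<lambda>i. J i \<omega>))))"
    by (rule Bochner_Integration.integral_sum) (rule fresh(2))
  also have "\<dots> = (\<Sum>i\<in>UNIV. prob {\<omega> \<in> space M. J j \<omega> = i} *\<^sub>R expectation (\<lambda>\<omega>. G i (F (\<lambda>i. J i \<omega>))))"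
    by (intro sum.cong refl fresh(1))
  finally show ?thesis .
qed

section \<open>The mean error of the method\<close>

definition error_reflection :: "real^'n^'m \<Rightarrow> 'm \<Rightarrow> real^'n \<Rightarrow> real^'n" where
  "error_reflection A i e = e - (2 * ((row i A \<bullet> e) / (norm (row i A))\<^sup>2)) *\<^sub>R row i A"

lemma linear_error_reflection: "linear (error_reflection A i)"
  by (rule linearI)
    (simp_all add: error_reflection_def inner_add_right add_divide_distrib algebra_simps)

lemma row_reflection_error:
  assumes "A *v xs = b"
  shows "row_reflection A b i z - xs = error_reflection A i (z - xs)"
proof -
  have "b $ i = row i A \<bullet> xs"
    using assms by (auto simp: matrix_mult_dot row_def)
  then show ?thesis
    by (simp add: row_reflection_def error_reflection_def inner_diff_right)
qed

text \<open>The selection probabilities cancel the normalisation of the reflections.\<close>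

lemma weighted_error_reflections:
  fixes A :: "real^'n^'m"
  assumes "A \<noteq> 0"
  shows "(\<Sum>i\<in>UNIV. ((norm (row i A))\<^sup>2 / (norm A)\<^sup>2) *\<^sub>R error_reflection A i e)
    = mean_reflection A e"
proof -
  have frob: "(\<Sum>i\<in>UNIV. (norm (row i A))\<^sup>2) = (norm A)\<^sup>2"
    by (simp add: norm_vec_def[of A] L2_set_def sum_nonneg row_def)
  have gram: "(A *v e) v* A = (\<Sum>i\<in>UNIV. (row i A \<bullet> e) *\<^sub>R row i A)"
    by (simp add: vec_eq_iff vector_matrix_mult_def matrix_mult_dot row_def mult.commute)
  have "((norm (row i A))\<^sup>2 / (norm A)\<^sup>2) *\<^sub>R error_reflection A i e
      = ((norm (row i A))\<^sup>2 / (norm A)\<^sup>2) *\<^sub>R e - (2 / (norm A)\<^sup>2) *\<^sub>R ((row i A \<bullet> e) *\<^sub>R row i A)" for i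
    by (cases "row i A = 0") (simp_all add: error_reflection_def scaleR_diff_right)
  then have "(\<Sum>i\<in>UNIV. ((norm (row i A))\<^sup>2 / (norm A)\<^sup>2) *\<^sub>R error_reflection A i e)
      = ((\<Sum>i\<in>UNIV. (norm (row i A))\<^sup>2) / (norm A)\<^sup>2) *\<^sub>R e
        - (2 / (norm A)\<^sup>2) *\<^sub>R (\<Sum>i\<in>UNIV. (row i A \<bullet> e) *\<^sub>R row i A)"
    by (simp add: sum_subtractf scaleR_sum_left scaleR_sum_right sum_divide_distrib)
  then show ?thesis
    using assms by (simp add: frob gram mean_reflection_def)
qed

lemma reflections_cong:
  assumes "\<And>l'. 1 \<le> l' \<Longrightarrow> l' \<le> l \<Longrightarrow> js l' = js' l'"
  shows "reflections A b js x l = reflections A b js' x l"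
  using assms by (induction l) auto

lemma mRrDR_cong:
  assumes "\<And>k' l. 1 \<le> k' \<Longrightarrow> k' < k \<Longrightarrow> 1 \<le> l \<Longrightarrow> l \<le> r \<Longrightarrow> j k' l = j' k' l"
  shows "mRrDR A b r \<alpha> \<beta> x0 x1 j k = mRrDR A b r \<alpha> \<beta> x0 x1 j' k"
  using assms
proof (induction A b r \<alpha> \<beta> x0 x1 j k rule: mRrDR.induct)
  case (3 A b r \<alpha> \<beta> x0 x1 j k)
  have "mRrDR A b r \<alpha> \<beta> x0 x1 j (Suc k) = mRrDR A b r \<alpha> \<beta> x0 x1 j' (Suc k)"
    and "mRrDR A b r \<alpha> \<beta> x0 x1 j k = mRrDR A b r \<alpha> \<beta> x0 x1 j' k"
    using 3 by simp_all
  moreover have "reflections A b (j (Suc k)) x r = reflections A b (j' (Suc k)) x r" for x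
    using "3.prems"[of "Suc k"] by (intro reflections_cong) auto
  ultimately show ?case by simp
qed simp_all

text \<open>The reflection number \<open>l + 1\<close> of step \<open>k\<close> uses a selection that is independent of those
  that have produced its argument, so that in the mean it acts as \<open>mean_reflection\<close>.\<close>

lemma expected_reflections:
  fixes A :: "real^'n^'m" and J :: "nat \<Rightarrow> nat \<Rightarrow> 'w \<Rightarrow> 'm" and x0 x1 xs :: "real^'n"
    and \<alpha> \<beta> :: real
  assumes sel: "random_row_selections M A r J" and A0: "A \<noteq> 0" and xs: "A *v xs = b"
    and k: "k \<ge> 1"
  defines "Z \<equiv> \<lambda>l \<omega>. reflections A b (\<lambda>l. J k l \<omega>) (mRrDR A b r \<alpha> \<beta> x0 x1 (\<lambda>k l. J k l \<omega>) k) l"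
  shows "l \<le> r \<Longrightarrow> integrable M (Z l)"
    and "l \<le> r \<Longrightarrow> prob_space.expectation M (\<lambda>\<omega>. Z l \<omega> - xs)
      = (mean_reflection A ^^ l) (prob_space.expectation M (\<lambda>\<omega>. Z 0 \<omega> - xs))"
proof -
  interpret prob_space M
    using sel by (simp add: random_row_selections_def)
  let ?J = "\<lambda>(k, l). J k l" and ?I = "{1..} \<times> {1..r}"
  have ind: "indep_vars (\<lambda>_. count_space UNIV) ?J ?I"
    using sel by (simp add: random_row_selections_def)
  define F where "F l f = reflections A b (\<lambda>l. f (k, l))
    (mRrDR A b r \<alpha> \<beta> x0 x1 (\<lambda>k l. f (k, l)) k) l - xs" for l and f :: "nat \<times> nat \<Rightarrow> 'm"
  define K where "K l = {1..<k} \<times> {1..r} \<union> {k} \<times> {1..l}" for l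
  have K: "finite (K l)" "(k, Suc l) \<notin> K l" for l
    by (auto simp: K_def)
  have KI: "K l \<subseteq> ?I" if "l \<le> r" for l
    using that k by (auto simp: K_def)
  have dep: "F l f = F l g" if "\<And>p. p \<in> K l \<Longrightarrow> f p = g p" for l f g
  proof -
    have "mRrDR A b r \<alpha> \<beta> x0 x1 (\<lambda>k l. f (k, l)) k = mRrDR A b r \<alpha> \<beta> x0 x1 (\<lambda>k l. g (k, l)) k"
      by (rule mRrDR_cong) (auto simp: K_def intro!: that)
    moreover have "reflections A b (\<lambda>l. f (k, l)) x l = reflections A b (\<lambda>l. g (k, l)) x l" for x
      by (rule reflections_cong) (auto simp: K_def intro!: that)
    ultimately show ?thesis
      by (simp add: F_def)
  qed
  have FZ: "F l (\<lambda>p. ?J p \<omega>) = Z l \<omega> - xs" for l \<omega>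
    by (simp add: F_def Z_def)
  have int: "integrable M (\<lambda>\<omega>. Z l \<omega> - xs)" if "l \<le> r" for l
  proof -
    have "random_variable (count_space UNIV) (?J p)" if "p \<in> K l" for p
      using ind KI[OF \<open>l \<le> r\<close>] that unfolding indep_vars_def by blast
    then have "integrable M (\<lambda>\<omega>. F l (\<lambda>p. ?J p \<omega>))"
      by (rule integrable_finite_history[OF _ K(1)[of l] dep])
    then show ?thesis
      by (simp add: FZ)
  qed
  show "integrable M (Z l)" if "l \<le> r"
    using Bochner_Integration.integrable_add[OF int[OF that], of "\<lambda>_. xs"] by simp
  show "expectation (\<lambda>\<omega>. Z l \<omega> - xs) = (mean_reflection A ^^ l) (expectation (\<lambda>\<omega>. Z 0 \<omega> - xs))"
    if "l \<le> r"
    using that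
  proof (induction l)
    case (Suc l)
    then have l: "l \<le> r" "(k, Suc l) \<in> ?I"
      using k by auto
    have prob: "prob {\<omega> \<in> space M. J k (Suc l) \<omega> = i} = (norm (row i A))\<^sup>2 / (norm A)\<^sup>2" for i
      using sel k Suc.prems by (simp add: random_row_selections_def frobenius_norm_eq_norm)
    have "expectation (\<lambda>\<omega>. Z (Suc l) \<omega> - xs)
        = expectation (\<lambda>\<omega>. error_reflection A (?J (k, Suc l) \<omega>) (F l (\<lambda>p. ?J p \<omega>)))"
      unfolding FZ by (simp add: Z_def row_reflection_error[OF xs])
    also have "\<dots> = (\<Sum>i\<in>UNIV. prob {\<omega> \<in> space M. ?J (k, Suc l) \<omega> = i} *\<^sub>R
        expectation (\<lambda>\<omega>. error_reflection A i (F l (\<lambda>p. ?J p \<omega>))))"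
      by (rule expectation_fresh_selection[OF ind K(1) KI[OF l(1)] l(2) K(2) dep])
    also have "\<dots> = (\<Sum>i\<in>UNIV. ((norm (row i A))\<^sup>2 / (norm A)\<^sup>2) *\<^sub>R
        expectation (\<lambda>\<omega>. error_reflection A i (Z l \<omega> - xs)))"
      unfolding FZ by (simp add: prob)
    also have "\<dots> = (\<Sum>i\<in>UNIV. ((norm (row i A))\<^sup>2 / (norm A)\<^sup>2) *\<^sub>R
        error_reflection A i (expectation (\<lambda>\<omega>. Z l \<omega> - xs)))"
      by (intro sum.cong refl arg_cong[where f = "scaleR _"] integral_bounded_linear int l
          linear_conv_bounded_linear[THEN iffD1] linear_error_reflection)
    also have "\<dots> = mean_reflection A (expectation (\<lambda>\<omega>. Z l \<omega> - xs))"
      by (rule weighted_error_reflections[OF A0])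
    finally show ?case
      using Suc.IH l by simp
  qed simp
qed

text \<open>The influence of the current mean error on the next one; the previous mean error enters
  separately, with the factor \<open>- \<beta>\<close>.\<close>

definition mean_step :: "real^'n^'m \<Rightarrow> nat \<Rightarrow> real \<Rightarrow> real \<Rightarrow> real^'n \<Rightarrow> real^'n" where
  "mean_step A r \<alpha> \<beta> v = (1 - \<alpha> + \<beta>) *\<^sub>R v + \<alpha> *\<^sub>R (mean_reflection A ^^ r) v"

lemma expected_error_recurrence:
  fixes A :: "real^'n^'m" and J :: "nat \<Rightarrow> nat \<Rightarrow> 'w \<Rightarrow> 'm" and x0 x1 xs :: "real^'n"
    and \<alpha> \<beta> :: real
  assumes sel: "random_row_selections M A r J" and A0: "A \<noteq> 0" and xs: "A *v xs = b"
  defines "e \<equiv> \<lambda>k. prob_space.expectation M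
    (\<lambda>\<omega>. mRrDR A b r \<alpha> \<beta> x0 x1 (\<lambda>k l. J k l \<omega>) k - xs)"
  shows "e (Suc (Suc k)) = mean_step A r \<alpha> \<beta> (e (Suc k)) - \<beta> *\<^sub>R e k"
    and "e 0 = x0 - xs" and "e (Suc 0) = x1 - xs"
proof -
  interpret prob_space M
    using sel by (simp add: random_row_selections_def)
  show "e 0 = x0 - xs" "e (Suc 0) = x1 - xs"
    by (simp_all add: e_def prob_space)
  define X where "X k \<omega> = mRrDR A b r \<alpha> \<beta> x0 x1 (\<lambda>k l. J k l \<omega>) k" for k \<omega>
  define Z where "Z \<omega> = reflections A b (\<lambda>l. J (Suc k) l \<omega>) (X (Suc k) \<omega>) r" for \<omega>
  have intX: "integrable M (X k)" for k
  proof (cases k)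
    case 0
    then show ?thesis by (simp add: X_def[abs_def])
  next
    case (Suc k')
    then show ?thesis
      using expected_reflections(1)[OF sel A0 xs, of k 0 \<alpha> \<beta> x0 x1]
      by (simp add: X_def[abs_def])
  qed
  have intZ: "integrable M Z"
    using expected_reflections(1)[OF sel A0 xs, of "Suc k" r \<alpha> \<beta> x0 x1]
    by (simp add: X_def[abs_def] Z_def[abs_def])
  have expZ: "expectation (\<lambda>\<omega>. Z \<omega> - xs) = (mean_reflection A ^^ r) (e (Suc k))"
    using expected_reflections(2)[OF sel A0 xs, of "Suc k" r \<alpha> \<beta> x0 x1]
    by (simp add: X_def Z_def e_def)
  have eX: "e k = expectation (\<lambda>\<omega>. X k \<omega> - xs)" for k
    by (simp add: e_def X_def)
  have "X (Suc (Suc k)) \<omega> - xs = (1 - \<alpha> + \<beta>) *\<^sub>R (X (Suc k) \<omega> - xs) + \<alpha> *\<^sub>R (Z \<omega> - xs)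
      - \<beta> *\<^sub>R (X k \<omega> - xs)" for \<omega>
    by (simp add: X_def Z_def algebra_simps)
  then have "e (Suc (Suc k)) = expectation (\<lambda>\<omega>. (1 - \<alpha> + \<beta>) *\<^sub>R (X (Suc k) \<omega> - xs)
      + \<alpha> *\<^sub>R (Z \<omega> - xs) - \<beta> *\<^sub>R (X k \<omega> - xs))"
    by (simp only: eX)
  also have "\<dots> = (1 - \<alpha> + \<beta>) *\<^sub>R e (Suc k) + \<alpha> *\<^sub>R expectation (\<lambda>\<omega>. Z \<omega> - xs) - \<beta> *\<^sub>R e k"
    unfolding eX by (simp add: intX intZ)
  finally show "e (Suc (Suc k)) = mean_step A r \<alpha> \<beta> (e (Suc k)) - \<beta> *\<^sub>R e k"
    by (simp add: expZ mean_step_def)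
qed

section \<open>Second-order recurrences with a contracted leading operator\<close>

text \<open>For a scalar recurrence whose characteristic polynomial has the complex conjugate roots \<open>z\<close>
  and \<open>w\<close>, the quantity \<open>V k = (e (k + 1) - z * e k) * (e (k + 1) - w * e k)\<close> is real, is
  multiplied by \<open>z * w = \<beta>\<close> in each step, and is definite because the discriminant is negative.
  Expanded into a quadratic form, it also makes sense for a symmetric operator \<open>Q\<close> in place of the
  scalar, and it has the same two properties along the sequence. This avoids diagonalising \<open>Q\<close>.\<close>

lemma momentum_recurrence_decay:
  fixes e :: "nat \<Rightarrow> 'a::real_inner"
  assumes rec: "\<And>k. e (Suc (Suc k)) = Q (e (Suc k)) - \<beta> *\<^sub>R e k"
    and sym: "\<And>u v. Q u \<bullet> v = u \<bullet> Q v"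
    and bound: "\<And>k. norm (Q (e k)) \<le> c * norm (e k)"
    and discriminant: "c\<^sup>2 < 4 * \<beta>"
  shows "\<exists>C>0. \<forall>k. (norm (e k))\<^sup>2 \<le> \<beta> ^ k * C"
proof -
  have \<beta>0: "\<beta> > 0"
    using discriminant zero_le_power2[of c] by linarith
  define V where "V k = (norm (e (Suc k)))\<^sup>2 - Q (e k) \<bullet> e (Suc k) + \<beta> * (norm (e k))\<^sup>2" for k
  have "V (Suc k) = \<beta> * V k" for k
  proof -
    let ?q = "Q (e (Suc k))"
    have "V (Suc k) = (?q - \<beta> *\<^sub>R e k) \<bullet> (?q - \<beta> *\<^sub>R e k) - ?q \<bullet> (?q - \<beta> *\<^sub>R e k)
        + \<beta> * (norm (e (Suc k)))\<^sup>2"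
      by (simp only: V_def rec power2_norm_eq_inner)
    also have "\<dots> = \<beta> * (norm (e (Suc k)))\<^sup>2 - \<beta> * (e k \<bullet> ?q) + \<beta> * (\<beta> * (norm (e k))\<^sup>2)"
      by (simp add: inner_diff_left inner_diff_right power2_norm_eq_inner inner_commute
          right_diff_distrib)
    also have "e k \<bullet> ?q = Q (e k) \<bullet> e (Suc k)"
      by (simp add: sym)
    finally show ?thesis
      by (simp add: V_def algebra_simps)
  qed
  then have V: "V k = \<beta> ^ k * V 0" for k
    by (induction k) simp_all
  define d where "d = \<beta> - c\<^sup>2 / 4"
  have d0: "d > 0"
    using discriminant by (simp add: d_def)
  have lower: "d * (norm (e k))\<^sup>2 \<le> V k" for k
  proof -
    have "Q (e k) \<bullet> e (Suc k) \<le> norm (Q (e k)) * norm (e (Suc k))"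
      by (rule norm_cauchy_schwarz)
    also have "\<dots> \<le> (norm (e (Suc k)))\<^sup>2 + (norm (Q (e k)))\<^sup>2 / 4"
      using zero_le_power2[of "norm (e (Suc k)) - norm (Q (e k)) / 2"]
      by (simp add: power2_diff power_divide mult.commute)
    also have "(norm (Q (e k)))\<^sup>2 \<le> c\<^sup>2 * (norm (e k))\<^sup>2"
      using power_mono[OF bound[of k], of 2] by (simp add: power_mult_distrib)
    finally show ?thesis
      by (simp add: V_def d_def left_diff_distrib)
  qed
  have "(norm (e k))\<^sup>2 \<le> \<beta> ^ k * (V 0 / d + 1)" for k
  proof -
    have "(norm (e k))\<^sup>2 \<le> \<beta> ^ k * V 0 / d"
      using lower[of k] V[of k] d0 by (simp add: pos_le_divide_eq mult.commute)
    also have "\<dots> \<le> \<beta> ^ k * (V 0 / d + 1)"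
      using \<beta>0 by (simp add: distrib_left)
    finally show ?thesis .
  qed
  moreover have "0 \<le> d * (norm (e 0))\<^sup>2"
    using d0 by simp
  then have "V 0 / d + 1 > 0"
    using lower[of 0] d0 by (intro add_nonneg_pos divide_nonneg_pos) linarith+
  ultimately show ?thesis by blast
qed

text \<open>The discriminant is that of \<open>z\<^sup>2 - (1 - p + \<beta>) * z + \<beta>\<close>, the characteristic polynomial of the
  momentum recurrence in a direction where the method without momentum contracts by \<open>1 - p\<close>. Its
  sign is decided by \<open>1 - sqrt \<beta> < sqrt p\<close>, which is the lower bound on \<open>\<beta>\<close> solved for \<open>p\<close>.\<close>

lemma negative_discriminant:
  fixes p \<beta> :: real
  assumes p: "0 \<le> p" "p \<le> 1" and \<beta>: "(1 - sqrt p)\<^sup>2 < \<beta>" "\<beta> < 1"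
  shows "(1 - p + \<beta>)\<^sup>2 < 4 * \<beta>"
proof -
  have \<beta>0: "\<beta> > 0"
    using \<beta>(1) zero_le_power2[of "1 - sqrt p"] by linarith
  have "1 - sqrt p < sqrt \<beta>"
    using \<beta>(1) by (rule real_less_rsqrt)
  moreover have "sqrt \<beta> < 1"
    using \<beta>(2) by simp
  ultimately have "(1 - sqrt \<beta>)\<^sup>2 < (sqrt p)\<^sup>2"
    by (intro power_strict_mono) auto
  then have "1 - p + \<beta> < 2 * sqrt \<beta>"
    using p \<beta>0 by (simp add: power2_diff)
  then have "(1 - p + \<beta>)\<^sup>2 < (2 * sqrt \<beta>)\<^sup>2"
    using p \<beta>0 by (intro power_strict_mono) auto
  then show ?thesis
    using \<beta>0 by (simp add: power_mult_distrib)
qed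

section \<open>Decay of the mean error\<close>

theorem theorem4p2:
  fixes A :: "real^'n^'m" and b :: "real^'m"
    and x0 x1 xstar :: "real^'n"
    and r :: nat and \<alpha> \<beta> :: real
    and M :: "'w measure" and J :: "nat \<Rightarrow> nat \<Rightarrow> 'w \<Rightarrow> 'm"
    and X :: "nat \<Rightarrow> 'w \<Rightarrow> real^'n"
  assumes rank: "rank A \<ge> 2"
    and consistent: "\<exists>x. A *v x = b"
    and r_pos: "r > 0"
    and init: "x1 = x0"
    and xstar: "xstar = pinv A *v b + (mat 1 - pinv A ** A) *v x0"
    and selections: "random_row_selections M A r J"
    and iterates: "\<And>k \<omega>. X k \<omega> = mRrDR A b r \<alpha> \<beta> x0 x1 (\<lambda>k l. J k l \<omega>) k"
    and alpha_pos: "0 < \<alpha>"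
    and alpha_less: "\<alpha> < min 1 (1 / (1 - (1 - 2 * (sigma_max A)\<^sup>2 / (frobenius_norm A)\<^sup>2) ^ r))"
    and beta_greater:
      "(1 - sqrt (\<alpha> * (1 - (1 - 2 * ((sigma_min A)\<^sup>2 / (frobenius_norm A)\<^sup>2)) ^ r)))\<^sup>2 < \<beta>"
    and beta_less: "\<beta> < 1"
  shows "\<exists>c>0. \<forall>k. (norm (prob_space.expectation M (\<lambda>\<omega>. X k \<omega> - xstar)))\<^sup>2 \<le> \<beta> ^ k * c"
proof -
  define e where "e k = prob_space.expectation M (\<lambda>\<omega>. X k \<omega> - xstar)" for k
  define t where "t = 1 - 2 * ((sigma_min A)\<^sup>2 / (norm A)\<^sup>2)"
  define p where "p = \<alpha> * (1 - t ^ r)"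
  let ?T = "mean_reflection A" and ?Q = "mean_step A r \<alpha> \<beta>"
  have A0: "A \<noteq> 0"
    using rank rank_0 by fastforce
  note solution = pinv_affine_solution[OF consistent xstar]
  have W: "subspace (row_space A)"
    by (rule subspace_row_space)
  have rec: "e (Suc (Suc k)) = ?Q (e (Suc k)) - \<beta> *\<^sub>R e k" for k
    unfolding e_def iterates by (rule expected_error_recurrence(1)[OF selections A0 solution(1)])
  have start: "e 0 = x0 - xstar" "e (Suc 0) = x0 - xstar"
    unfolding e_def iterates init
    by (rule expected_error_recurrence(2,3)[OF selections A0 solution(1)])+
  have QW: "?Q v \<in> row_space A" if "v \<in> row_space A" for v
    unfolding mean_step_def using mean_reflection_power_contraction[OF rank that]
    by (intro subspace_add[OF W] subspace_scale[OF W] that) auto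
  have "e k \<in> row_space A \<and> e (Suc k) \<in> row_space A" for k
  proof (induction k)
    case (Suc k)
    then show ?case
      unfolding rec by (intro conjI subspace_diff[OF W] subspace_scale[OF W] QW) auto
  qed (simp add: start solution(2))
  then have eW: "e k \<in> row_space A" for k
    by blast
  have "t \<ge> 0"
    unfolding t_def by (rule mean_reflection_contraction(2)[OF rank])
  moreover have "t \<le> 1"
    by (simp add: t_def)
  ultimately have tr: "0 \<le> t ^ r" "t ^ r \<le> 1"
    by (simp_all add: power_le_one)
  have p: "0 \<le> p" "p \<le> 1"
    using alpha_pos alpha_less tr mult_mono[of \<alpha> 1 "1 - t ^ r" 1] by (simp_all add: p_def)
  have \<beta>p: "(1 - sqrt p)\<^sup>2 < \<beta>"
    using beta_greater by (simp add: p_def t_def frobenius_norm_eq_norm)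
  have \<beta>0: "\<beta> > 0"
    using \<beta>p zero_le_power2[of "1 - sqrt p"] by linarith
  have sym: "?Q u \<bullet> v = u \<bullet> ?Q v" for u v
    by (simp add: mean_step_def inner_add_left inner_add_right mean_reflection_power_symmetric)
  \<comment> \<open>Because both coefficients of the mean step are nonnegative, the triangle inequality loses
    nothing against the largest eigenvalue that \<open>t\<close> permits.\<close>
  have bound: "norm (?Q (e k)) \<le> (1 - p + \<beta>) * norm (e k)" for k
  proof -
    have "norm (?Q (e k)) \<le> (1 - \<alpha> + \<beta>) * norm (e k) + \<alpha> * norm ((?T ^^ r) (e k))"
      unfolding mean_step_def using alpha_pos alpha_less \<beta>0 by (intro norm_triangle_le) simp
    also have "\<dots> \<le> (1 - \<alpha> + \<beta>) * norm (e k) + \<alpha> * (t ^ r * norm (e k))"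
      using mean_reflection_power_contraction[OF rank eW] alpha_pos
      by (simp add: t_def mult_left_mono)
    also have "\<dots> = (1 - p + \<beta>) * norm (e k)"
      by (simp add: p_def algebra_simps)
    finally show ?thesis .
  qed
  have "\<exists>C>0. \<forall>k. (norm (e k))\<^sup>2 \<le> \<beta> ^ k * C"
    by (rule momentum_recurrence_decay[where Q = ?Q and c = "1 - p + \<beta>"])
      (fact rec sym bound negative_discriminant[OF p \<beta>p beta_less])+
  then show ?thesis
    by (simp add: e_def)
qed

end
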